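(* Let $k \le n$ be nonnegative integers. The number of pairs $(T,v)$, where $T$ is a rooted tree with vertex set $[n]=\{1,\dots,n\}$ and $v$ is a record of $T$ at height $k-1$, equals the number of connected endofunctions $f:[n]\to[n]$ of girth $k$.
   Context: All trees are labeled. A rooted tree on $[n]$ has vertex set $[n]$ and a distinguished root. A node $v$ of a rooted tree is a record if its label is the largest label on the unique path from $v$ to the root (both endpoints included). The height of a node is the number of edges on the path from it to the root. An endofunction on $[n]$ is a map $f:[n]\to[n]$; its functional graph is the directed graph on $[n]$ with edges $(i,f(i))$. The endofunction is connected if its functional graph is connected when orientations are ignored; its girth is then the number of edges of the unique directed cycle of its functional graph. *)

theory Defs
  imports "Graph_Theory.Digraph_Component" "HOL-Library.FuncSet"
begin

text \<open>
  Simple graphs are those of the library (locale \<open>pair_graph\<close>): each undirected edge is stored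
  as two opposite arcs, so a graph is determined by its vertex set and edge set and counting
  records counts labelled graphs. In this representation every edge \<open>ab\<close> yields the directed
  cycle \<open>a, b, a\<close>, which is not a cycle of the undirected graph; the cycles of the undirected
  graph are the directed cycles with at least three arcs. For this reason the library predicate
  \<open>tree\<close>, which forbids all directed cycles, does not describe undirected trees.
  The library predicate \<open>connected\<close> ignores orientations and requires a vertex.
\<close>

definition undirected_tree :: "'a pair_pre_digraph \<Rightarrow> bool" where
  "undirected_tree T \<longleftrightarrow>
     pair_graph T \<and> connected (with_proj T) \<and>
     \<not> (\<exists>p. pre_digraph.cycle (with_proj T) p \<and> 3 \<le> length p)"

definition rooted_tree_on :: "nat \<Rightarrow> nat pair_pre_digraph \<Rightarrow> nat \<Rightarrow> bool" where
  "rooted_tree_on n T r \<longleftrightarrow> undirected_tree T \<and> pverts T = {1..n} \<and> r \<in> pverts T"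

definition path_to_root :: "'a pair_pre_digraph \<Rightarrow> 'a \<Rightarrow> 'a \<Rightarrow> ('a \<times> 'a) list" where
  "path_to_root T r v = (THE p. pre_digraph.apath (with_proj T) v p r)"

definition height :: "'a pair_pre_digraph \<Rightarrow> 'a \<Rightarrow> 'a \<Rightarrow> nat" where
  "height T r v = length (path_to_root T r v)"

definition is_record :: "nat pair_pre_digraph \<Rightarrow> nat \<Rightarrow> nat \<Rightarrow> bool" where
  "is_record T r v \<longleftrightarrow>
     v \<in> pverts T \<and>
     (\<forall>u \<in> set (pre_digraph.awalk_verts (with_proj T) v (path_to_root T r v)). u \<le> v)"

definition functional_graph :: "nat \<Rightarrow> (nat \<Rightarrow> nat) \<Rightarrow> nat pair_pre_digraph" where
  "functional_graph n f = \<lparr> pverts = {1..n}, parcs = (\<lambda>i. (i, f i)) ` {1..n} \<rparr>"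

definition connected_endofunction :: "nat \<Rightarrow> (nat \<Rightarrow> nat) \<Rightarrow> bool" where
  "connected_endofunction n f \<longleftrightarrow> connected (with_proj (functional_graph n f))"

text \<open>
  A library cycle is a list of arcs with a chosen starting point, and loops count as cycles of
  length one. The directed cycle of a connected endofunction is unique only up to rotation, so
  it is taken here as its set of arcs. The value is meaningful only for connected endofunctions.
\<close>

definition girth :: "nat \<Rightarrow> (nat \<Rightarrow> nat) \<Rightarrow> nat" where
  "girth n f =
     card (THE C. \<exists>p. pre_digraph.cycle (with_proj (functional_graph n f)) p \<and> C = set p)"

end

theory Submission
  imports Defs "HOL-Combinatorics.Orbits"
begin

text \<open>
  Orient the edges of a rooted tree \<open>T\<close> towards the root \<open>r\<close> and add the arc from \<open>r\<close> to
  \<open>v\<close>. The result is a connected endofunction whose cycle consists of the path from \<open>v\<close> to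
  \<open>r\<close> and the new arc, and \<open>v\<close> is a record if and only if it is the largest element of this
  cycle. Conversely, \<open>T\<close> is recovered from the endofunction by removing the arc of the cycle that
  enters its largest element.
  Both sides are therefore in bijection with the pairs \<open>(f, r)\<close> such that every element reaches
  \<open>r\<close> under iteration of \<open>f\<close>, \<open>f r\<close> is the largest element of the orbit of \<open>r\<close>, and
  this orbit has \<open>k\<close> elements.
\<close>

section \<open>Walks along iterates of a function\<close>

definition fwalk :: "('a \<Rightarrow> 'a) \<Rightarrow> 'a \<Rightarrow> nat \<Rightarrow> ('a \<times> 'a) list" where
  "fwalk f u m = map (\<lambda>i. ((f ^^ i) u, (f ^^ Suc i) u)) [0..<m]"

lemma length_fwalk [simp]: "length (fwalk f u m) = m"
  by (simp add: fwalk_def)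

lemma set_fwalk: "set (fwalk f u m) = (\<lambda>y. (y, f y)) ` (\<lambda>i. (f ^^ i) u) ` {..<m}"
  by (simp add: fwalk_def image_image atLeast0LessThan)

lemma fwalk_0 [simp]: "fwalk f u 0 = []"
  by (simp add: fwalk_def)

lemma fwalk_Suc: "fwalk f u (Suc m) = (u, f u) # fwalk f (f u) m"
  by (simp only: fwalk_def upt_conv_Cons[OF zero_less_Suc] map_Suc_upt[symmetric])
    (simp add: funpow_swap1)

lemma pcas_fwalk: "pcas u (fwalk f u m) v \<longleftrightarrow> v = (f ^^ m) u"
  by (induction m arbitrary: u) (auto simp: fwalk_Suc funpow_swap1)

lemma pawalk_verts_fwalk: "pawalk_verts u (fwalk f u m) = map (\<lambda>i. (f ^^ i) u) [0..<Suc m]"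
proof (induction m arbitrary: u)
  case (Suc m)
  show ?case
    by (simp only: fwalk_Suc pawalk_verts.simps Suc fst_conv snd_conv
        upt_conv_Cons[OF zero_less_Suc, of "Suc m"] map_Suc_upt[symmetric])
      (simp add: funpow_swap1)
qed simp

text \<open>Each arc of \<open>p\<close> is fixed by its tail through \<open>f\<close>, so the walk
  is fixed by its start and its length.\<close>

lemma pcas_eq_fwalk:
  assumes "\<And>e. e \<in> set p \<Longrightarrow> snd e = f (fst e)" "pcas u p v"
  shows "p = fwalk f u (length p)"
  using assms
proof (induction p arbitrary: u)
  case (Cons e p)
  have "fst e = u" "snd e = f u" "pcas (f u) p v"
    using Cons.prems(1)[of e] Cons.prems(2) by auto
  then show ?case
    using Cons.IH[of "f u"] Cons.prems(1) by (cases e) (simp add: fwalk_Suc)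
qed simp

section \<open>Orbits and periodic points\<close>

lemma orbit_subset_closed:
  assumes "x \<in> A" "f ` A \<subseteq> A"
  shows "orbit f x \<subseteq> A"
proof
  fix y
  assume "y \<in> orbit f x"
  then show "y \<in> A" by induction (use assms in auto)
qed

lemma funpow_closed: "x \<in> A \<Longrightarrow> f ` A \<subseteq> A \<Longrightarrow> (f ^^ i) x \<in> A"
  by (induction i) auto

text \<open>Pigeonhole: two iterates of a point coincide, and the earlier one returns to itself. As
  \<open>orbit f x\<close> collects only iterates with positive exponent,
  \<open>x \<in> orbit f x\<close> says that \<open>x\<close> is periodic.\<close>

lemma finite_closed_has_periodic:
  assumes "finite A" "A \<noteq> {}" "f ` A \<subseteq> A"
  obtains x where "x \<in> A" "x \<in> orbit f x"
proof -
  obtain a where a: "a \<in> A" using assms by blast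
  have mem: "(f ^^ i) a \<in> A" for i using a assms(3) by (rule funpow_closed)
  then have "\<not> inj (\<lambda>i. (f ^^ i) a)"
    using assms(1) by (metis finite_imageD finite_subset image_subsetI infinite_UNIV_nat)
  then obtain i j where ij: "i < j" "(f ^^ i) a = (f ^^ j) a"
    by (metis (no_types, lifting) injI linorder_neqE_nat)
  have "(f ^^ (j - i)) ((f ^^ i) a) = (f ^^ (j - i + i)) a"
    by (simp only: funpow_add comp_apply)
  then have "(f ^^ (j - i)) ((f ^^ i) a) = (f ^^ i) a"
    using ij by simp
  then have "(f ^^ i) a \<in> orbit f ((f ^^ i) a)"
    unfolding orbit_altdef using ij(1) by (metis (mono_tags, lifting) mem_Collect_eq zero_less_diff)
  then show ?thesis using that mem by blast
qed

lemma orbit_eq_of_periodic: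
  assumes "x \<in> orbit f x" "y \<in> orbit f x"
  shows "orbit f y = orbit f x"
  using assms orbit_swap[OF assms] by (auto intro: orbit_trans)

text \<open>Listing the cycle from \<open>f x\<close> on makes it end at \<open>x\<close>; for a
  root \<open>r\<close> this is the order of the tree path from \<open>f r\<close> to
  \<open>r\<close>.\<close>

lemma orbit_eq_image_funpow:
  assumes "x \<in> orbit f x"
  shows "orbit f x = (\<lambda>i. (f ^^ i) (f x)) ` {..funpow_dist f (f x) x}"
proof -
  have "(f ^^ Suc (funpow_dist f (f x) x)) x = x"
    using assms by (rule funpow_dist1_prop)
  then have "orbit f (f x) = {(f ^^ m) (f x) |m. m < Suc (funpow_dist f (f x) x)}"
    by (intro orbit_altdef_bounded) (simp_all add: funpow_swap1)
  then show ?thesis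
    using self_in_orbit_step[OF assms] by (auto simp: less_Suc_eq_le)
qed

text \<open>The iterates of \<open>f x\<close> up to the first visit of \<open>x\<close> are
  distinct. The \<open>Suc\<close> is the shift between height \<open>k - 1\<close> and girth
  \<open>k\<close>.\<close>

lemma card_orbit:
  assumes "x \<in> orbit f x"
  shows "card (orbit f x) = Suc (funpow_dist f (f x) x)"
proof -
  have "x \<in> orbit f (f x)" using assms by (simp add: self_in_orbit_step)
  then have "inj_on (\<lambda>i. (f ^^ i) (f x)) {..funpow_dist f (f x) x}"
    by (auto intro!: inj_onI dest: funpow_neq_less_funpow_dist)
  then show ?thesis by (simp add: orbit_eq_image_funpow[OF assms] card_image)
qed

text \<open>\<open>f\<close> maps the cycle of \<open>x\<close> onto itself, and a surjective
  self-map of a finite set is injective.\<close>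

lemma inj_on_orbit:
  assumes "x \<in> orbit f x"
  shows "inj_on f (orbit f x)"
proof (rule eq_card_imp_inj_on)
  show "finite (orbit f x)" using assms by (rule finite_orbit)
  have "f ` orbit f x = orbit f x"
  proof
    show "f ` orbit f x \<subseteq> orbit f x" by (auto intro: orbit.step)
    show "orbit f x \<subseteq> f ` orbit f x"
    proof
      fix y assume "y \<in> orbit f x"
      then show "y \<in> f ` orbit f x"
        by cases (use assms in auto)
    qed
  qed
  then show "card (f ` orbit f x) = card (orbit f x)" by simp
qed

section \<open>Trees and unique paths\<close>

text \<open>Turns the distinct vertices in the definition of a cycle into distinct heads of arcs, a
  condition that survives rotation.\<close>

lemma tl_pawalk_verts: "pcas u p v \<Longrightarrow> tl (pawalk_verts u p) = map snd p"
proof (induction p arbitrary: u)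
  case (Cons e p)
  then show ?case by (cases p) auto
qed simp

text \<open>If the paths part at the first arc, following one to its first later vertex on the other
  and returning along the other gives a cycle with at least three arcs. Otherwise induction applies
  to the remaining paths.\<close>

lemma (in pair_sym_digraph) apath_unique:
  assumes acyclic: "\<nexists>p. cycle p \<and> 3 \<le> length p"
  shows "apath u p w \<Longrightarrow> apath u q w \<Longrightarrow> p = q"
proof (induction p arbitrary: u q)
  case Nil
  then show ?case using apath_nonempty_ends[of u q w] by (auto simp: apath_Nil_iff)
next
  case (Cons e p u q)
  have "q \<noteq> []" using Cons.prems apath_nonempty_ends by (auto simp: apath_Nil_iff)
  then obtain d q' where q: "q = d # q'" by (cases q) auto
  obtain a b where e: "e = (u, a)" and d: "d = (u, b)"
    using Cons.prems q by (cases e; cases d) (auto simp: apath_Cons_iff)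
  have p: "(u, a) \<in> parcs G" "apath a p w" "u \<notin> set (pawalk_verts a p)"
    using Cons.prems e by (auto simp: apath_Cons_iff)
  have q': "(u, b) \<in> parcs G" "apath b q' w" "u \<notin> set (pawalk_verts b q')"
    using Cons.prems q d by (auto simp: apath_Cons_iff)
  show ?case
  proof (cases "a = b")
    case True
    then show ?thesis using Cons.IH p q' q e d by blast
  next
    case False
    have "w \<in> set (pawalk_verts x s)" if "apath x s w" for x s
    proof -
      have "last (pawalk_verts x s) = w" using that by (auto simp: apath_def)
      then show ?thesis using last_in_set[OF awalk_verts_non_Nil[of x s]] by simp
    qed
    then have "w \<in> set (pawalk_verts a p)" "w \<in> set (pawalk_verts b q')"
      using p(2) q'(2) by blast+
    then obtain xs x zs where xs: "pawalk_verts a p = xs @ x # zs"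
      "x \<in> set (pawalk_verts b q')" "\<forall>y\<in>set xs. y \<notin> set (pawalk_verts b q')"
      using split_list_first_prop[of "pawalk_verts a p" "\<lambda>y. y \<in> set (pawalk_verts b q')"]
      by blast
    obtain ys zs' where ys: "pawalk_verts b q' = ys @ x # zs'"
      using xs(2) by (metis split_list)
    have casp: "pcas a p w" and casq: "pcas b q' w"
      using p q' by (auto simp: apath_def)
    obtain p1 p2 where p1: "pcas a p1 x" "p = p1 @ p2" "pawalk_verts a p1 = xs @ [x]"
      using awalk_decomp_verts[OF casp xs(1)] by metis
    obtain q1 q2 where q1: "pcas b q1 x" "q' = q1 @ q2" "pawalk_verts b q1 = ys @ [x]"
      using awalk_decomp_verts[OF casq ys] by metis
    have ap: "awalk u ((u, a) # p1) x" and aq: "awalk u ((u, b) # q1) x"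
      using p q' p1 q1 by (auto simp: awalk_def apath_def dest: in_arcsD1)
    then have cyc: "awalk u (((u, a) # p1) @ rev_path ((u, b) # q1)) u"
      by (blast intro: awalk_appendI awalk_rev_path')
    have "pawalk_verts x (rev_path ((u, b) # q1)) = x # rev ys @ [u]"
      using awalk_verts_rev_path[OF aq] q1(3) by simp
    then have "pawalk_verts u (((u, a) # p1) @ rev_path ((u, b) # q1)) = u # xs @ x # rev ys @ [u]"
      using awalk_verts_append[OF cyc] awlast_of_awalk[OF ap] p1(3) by simp
    \<comment> \<open>\<open>xs\<close> avoids the second path by the choice of \<open>x\<close>,
      and \<open>u\<close> lies on neither remaining path.\<close>
    moreover have "distinct (xs @ x # rev ys @ [u])"
      using p q' xs ys by (auto simp: apath_def)
    ultimately have "cycle (((u, a) # p1) @ rev_path ((u, b) # q1))"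
      using cyc unfolding cycle_def by (intro exI[of _ u]) simp
    \<comment> \<open>Were both empty, then \<open>a = x = b\<close>, and the walk would only go
      along an edge and back.\<close>
    moreover have "p1 \<noteq> [] \<or> q1 \<noteq> []" using False p1(1) q1(1) by auto
    then have "3 \<le> length (((u, a) # p1) @ rev_path ((u, b) # q1))"
      by (cases p1; cases q1) auto
    ultimately show ?thesis using acyclic by blast
  qed
qed

lemma connected_imp_reachable:
  assumes "connected (with_proj G)" "pair_sym_digraph G" "u \<in> pverts G" "v \<in> pverts G"
  shows "u \<rightarrow>\<^sup>*\<^bsub>with_proj G\<^esub> v"
proof -
  interpret pair_sym_digraph G by fact
  show ?thesis
    using assms reachable_mk_symmetric_eq[OF sym_arcs]
    by (auto simp: connected_def strongly_connected_def)
qed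

text \<open>Walks to \<open>r\<close> can be reversed in the symmetric closure, so any two vertices
  are joined through \<open>r\<close>.\<close>

lemma connected_if_reachable_to:
  assumes "pair_wf_digraph G" "r \<in> pverts G"
    and "\<And>u. u \<in> pverts G \<Longrightarrow> u \<rightarrow>\<^sup>*\<^bsub>with_proj G\<^esub> r"
  shows "connected (with_proj G)"
proof -
  interpret pair_wf_digraph G by fact
  interpret S: pair_wf_digraph "mk_symmetric G" by (rule wellformed_mk_symmetric)
  have to: "u \<rightarrow>\<^sup>*\<^bsub>mk_symmetric G\<^esub> r" if "u \<in> pverts G" for u
    using assms(3)[OF that] by (rule reachable_mk_symmetricI)
  have "r \<rightarrow>\<^sup>*\<^bsub>mk_symmetric G\<^esub> u" if "u \<in> pverts G" for u
    by (rule symmetric_reachable[OF symmetric_mk_symmetric to[OF that]])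
  with to show ?thesis
    unfolding connected_def strongly_connected_def using assms(2)
    by (auto intro: S.reachable_trans)
qed

section \<open>Functional graphs\<close>

lemma functional_graph_simps [simp]:
  "pverts (functional_graph n f) = {1..n}"
  "parcs (functional_graph n f) = (\<lambda>i. (i, f i)) ` {1..n}"
  by (simp_all add: functional_graph_def)

lemma pair_fin_digraph_functional_graph:
  "f ` {1..n} \<subseteq> {1..n} \<Longrightarrow> pair_fin_digraph (functional_graph n f)"
  by unfold_locales auto

text \<open>Meeting the orbit of \<open>a\<close> is preserved along each arc of an undirected walk,
  whichever way the arc points.\<close>

lemma connected_endofunction_orbits_meet:
  assumes "connected_endofunction n f" "a \<in> {1..n}" "b \<in> {1..n}"
  shows "orbit f a \<inter> orbit f b \<noteq> {}"
proof -
  have "(a, b) \<in> rtrancl_on {1..n} (parcs (mk_symmetric (with_proj (functional_graph n f))))"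
    using assms
    by (simp add: connected_endofunction_def connected_def strongly_connected_def reachable_def)
  then show ?thesis
  proof (induction rule: rtrancl_on_induct)
    case base
    then show ?case using orbit_nonempty by fast
  next
    case (step b c)
    then obtain y where y: "y \<in> orbit f a" "y \<in> orbit f b" by blast
    from step have "c = f b \<or> b = f c"
      by (auto simp: parcs_mk_symmetric)
    then show ?case
    proof
      \<comment> \<open>\<open>y\<close> may be \<open>c\<close> itself, which need not lie in
        \<open>orbit f c\<close>; \<open>f y\<close> always does.\<close>
      assume "c = f b"
      then have "f y \<in> orbit f a" "f y \<in> orbit f c"
        using y by (auto intro: orbit.step orbit_sim_step)
      then show ?thesis by blast
    next
      assume "b = f c"
      then have "y \<in> orbit f c" using y by (auto intro: orbit_subset)
      then show ?thesis using y by blast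
    qed
  qed
qed

text \<open>A common point of the two orbits lies on the cycle of \<open>r\<close>, and iteration
  leads from there back to \<open>r\<close>.\<close>

lemma connected_endofunction_periodic_in_orbit:
  assumes "connected_endofunction n f" "a \<in> {1..n}" "r \<in> {1..n}" "r \<in> orbit f r"
  shows "r \<in> orbit f a"
proof -
  obtain y where "y \<in> orbit f a" "y \<in> orbit f r"
    using connected_endofunction_orbits_meet[OF assms(1-3)] by blast
  then show ?thesis using orbit_swap[OF assms(4)] orbit_trans by metis
qed

text \<open>A vertex has only one outgoing arc, so a cycle has to follow the iterates of
  \<open>f\<close> from its starting vertex.\<close>

lemma set_cycle_functional_graph:
  assumes "f ` {1..n} \<subseteq> {1..n}" "pre_digraph.cycle (with_proj (functional_graph n f)) p"
  obtains u where "u \<in> {1..n}" "u \<in> orbit f u" "set p = (\<lambda>y. (y, f y)) ` orbit f u"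
proof -
  interpret pair_fin_digraph "functional_graph n f"
    using assms(1) by (rule pair_fin_digraph_functional_graph)
  obtain u where u: "awalk u p u" "p \<noteq> []" using assms(2) by (auto simp: cycle_def)
  then have un: "u \<in> {1..n}" and cas: "pcas u p u" and arcs: "set p \<subseteq> (\<lambda>i. (i, f i)) ` {1..n}"
    by (auto simp: awalk_def)
  have p: "p = fwalk f u (length p)"
    by (rule pcas_eq_fwalk[OF _ cas]) (use arcs in auto)
  then have per: "(f ^^ length p) u = u" using cas pcas_fwalk by metis
  have "orbit f u = {(f ^^ i) u |i. i < length p}"
    by (rule orbit_altdef_bounded[OF per]) (use u in simp)
  then have "set p = (\<lambda>y. (y, f y)) ` orbit f u"
    by (subst p) (auto simp: set_fwalk)
  moreover have "u \<in> orbit f u"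
    using per u(2) unfolding orbit_altdef by (metis (mono_tags, lifting) length_greater_0_conv mem_Collect_eq)
  ultimately show ?thesis using that un by blast
qed

text \<open>All cycles have the same arc set, so the description in \<open>girth\<close> denotes it;
  its arcs are counted by their tails.\<close>

lemma girth_eq_card_orbit:
  assumes maps: "f ` {1..n} \<subseteq> {1..n}" and con: "connected_endofunction n f"
    and r: "r \<in> {1..n}" "r \<in> orbit f r"
  shows "girth n f = card (orbit f r)"
proof -
  interpret pair_fin_digraph "functional_graph n f"
    using maps by (rule pair_fin_digraph_functional_graph)
  have uniq: "set p = (\<lambda>y. (y, f y)) ` orbit f r" if cyc: "cycle p" for p
  proof -
    obtain u where u: "u \<in> {1..n}" "u \<in> orbit f u" "set p = (\<lambda>y. (y, f y)) ` orbit f u"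
      using set_cycle_functional_graph[OF maps cyc] .
    have "u \<in> orbit f r"
      using connected_endofunction_periodic_in_orbit[OF con r(1) u(1,2)] .
    then show ?thesis using u(3) orbit_eq_of_periodic[OF r(2)] by simp
  qed
  \<comment> \<open>Existence: following \<open>f\<close> from \<open>r\<close> for \<open>m\<close>
    steps closes up, and a closed walk contains a cycle.\<close>
  obtain m where m: "0 < m" "(f ^^ m) r = r" using r(2) by (auto simp: orbit_altdef)
  have "(f ^^ i) r \<in> {1..n}" for i using r(1) maps by (rule funpow_closed)
  then have "awalk r (fwalk f r m) r"
    using r(1) m by (auto simp: awalk_def pcas_fwalk set_fwalk)
  then have "closed_w (fwalk f r m)" using m(1) by (auto simp: closed_w_def)
  then obtain p where "cycle p" using closed_w_imp_cycle by blast
  then have "(THE C. \<exists>p. cycle p \<and> C = set p) = (\<lambda>y. (y, f y)) ` orbit f r"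
    by (intro the_equality) (auto simp: uniq)
  then show ?thesis
    unfolding girth_def by (simp add: card_image inj_on_def)
qed

section \<open>The tree of a rooted map\<close>

text \<open>The value of \<open>f\<close> at the root is ignored here; it stores the record.\<close>

definition cut_graph :: "'a set \<Rightarrow> ('a \<Rightarrow> 'a) \<Rightarrow> 'a \<Rightarrow> 'a pair_pre_digraph" where
  "cut_graph V f r =
     \<lparr>pverts = V, parcs = (\<lambda>u. (u, f u)) ` (V - {r}) \<union> (\<lambda>u. (f u, u)) ` (V - {r})\<rparr>"

text \<open>The case \<open>u = r\<close> of the last condition makes \<open>r\<close> periodic, so
  one condition yields both the tree paths to \<open>r\<close> and the cycle through
  \<open>r\<close>.\<close>

locale rooted_map =
  fixes V :: "'a set" and f :: "'a \<Rightarrow> 'a" and r :: 'a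
  assumes finite_V: "finite V" and maps: "f ` V \<subseteq> V" and root: "r \<in> V"
    and reaches_root: "u \<in> V \<Longrightarrow> r \<in> orbit f u"
begin

abbreviation "T \<equiv> cut_graph V f r"

abbreviation depth :: "'a \<Rightarrow> nat" where
  "depth u \<equiv> funpow_dist f u r"

lemma cut_simps [simp]:
  "pverts T = V"
  "parcs T = (\<lambda>u. (u, f u)) ` (V - {r}) \<union> (\<lambda>u. (f u, u)) ` (V - {r})"
  by (simp_all add: cut_graph_def)

lemma funpow_in_V: "u \<in> V \<Longrightarrow> (f ^^ i) u \<in> V"
  using maps by (intro funpow_closed)

lemma depth_step: "u \<in> V \<Longrightarrow> u \<noteq> r \<Longrightarrow> depth u = Suc (depth (f u))"
  using funpow_dist_step reaches_root by metis

lemma no_fixpoint: "u \<in> V \<Longrightarrow> u \<noteq> r \<Longrightarrow> f u \<noteq> u"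
  using depth_step by fastforce

sublocale tree: pair_graph T
proof
  show "symmetric (with_proj T)"
    by (auto simp: symmetric_def sym_def)
qed (use finite_V maps in \<open>auto simp: image_subset_iff dest: no_fixpoint no_fixpoint[symmetric]\<close>)

lemma apath_fwalk:
  assumes "u \<in> V"
  shows "tree.apath u (fwalk f u (depth u)) r"
proof -
  \<comment> \<open>Before the first visit of \<open>r\<close>, no arc leaving \<open>r\<close> is
    used, so every arc of the walk belongs to the tree.\<close>
  have "(f ^^ i) u \<noteq> r" if "i < depth u" for i
    using that by (rule funpow_dist_least)
  then have "set (fwalk f u (depth u)) \<subseteq> parcs T"
    using funpow_in_V[OF assms] by (auto simp: fwalk_def)
  moreover have "pcas u (fwalk f u (depth u)) r"
    using funpow_dist_prop[OF reaches_root[OF assms]] by (simp add: pcas_fwalk)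
  moreover have "inj_on (\<lambda>i. (f ^^ i) u) {..depth u}"
    using reaches_root[OF assms] by (auto intro!: inj_onI dest: funpow_neq_less_funpow_dist)
  then have "distinct (pawalk_verts u (fwalk f u (depth u)))"
    by (simp add: pawalk_verts_fwalk distinct_map atLeast0LessThan lessThan_Suc_atMost del: upt_Suc)
  ultimately show ?thesis
    using assms by (simp add: tree.apath_def tree.awalk_def)
qed

lemma connected_tree: "connected (with_proj T)"
proof (rule connected_if_reachable_to)
  show "pair_wf_digraph T" ..
  show "r \<in> pverts T" using root by simp
  show "u \<rightarrow>\<^sup>*\<^bsub>with_proj T\<^esub> r" if "u \<in> pverts T" for u
    using that apath_fwalk tree.reachable_apath by auto
qed

text \<open>Every edge joins consecutive depths, with the shallower end the parent of the other; so
  a neighbour that is not deeper must be the parent.\<close>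

lemma arc_cases:
  assumes "(x, y) \<in> parcs T"
  shows "x \<in> V" "y \<in> V" "y = f x \<and> depth x = Suc (depth y) \<or> x = f y \<and> depth y = Suc (depth x)"
  using assms depth_step maps by auto

text \<open>
  A deepest vertex of a cycle has the same neighbour on both sides, namely its parent, and this
  is impossible on a cycle with at least three arcs.
\<close>

lemma no_cycle:
  assumes "tree.cycle p"
  shows "length p < 3"
proof (rule ccontr)
  assume len: "\<not> length p < 3"
  obtain s where s: "tree.awalk s p s" "distinct (tl (pawalk_verts s p))"
    using assms by (auto simp: tree.cycle_def)
  let ?S = "set (pawalk_verts s p)"
  have "Max (depth ` ?S) \<in> depth ` ?S" by (intro Max_in) (simp_all add: tree.awalk_verts_non_Nil)
  then obtain u where u: "u \<in> ?S" and "Max (depth ` ?S) = depth u" by blast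
  then have u_max: "depth x \<le> depth u" if "x \<in> ?S" for x
    using that by (metis List.finite_set Max_ge finite_imageI imageI)
  obtain q t where qt: "p = q @ t" "tree.awalk s q u" "tree.awalk u t s"
    using tree.awalk_decomp[OF s(1) u] by blast
  \<comment> \<open>The cycle is rotated to start and end at the deepest vertex
    \<open>u\<close>.\<close>
  define c where "c = t @ q"
  have c: "tree.awalk u c u" using qt by (auto simp: c_def)
  have "distinct (map snd p)" using s tl_pawalk_verts[of s p s] by (auto simp: tree.awalk_def)
  then have dist: "distinct (map snd c)" by (auto simp: c_def qt(1))
  have len_c: "3 \<le> length c" using len by (simp add: c_def qt(1))
  have c_max: "depth (fst e) \<le> depth u" "depth (snd e) \<le> depth u" if "e \<in> set c" for e
    using that u_max tree.set_awalk_verts[OF s(1)] by (auto simp: c_def qt(1))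
  obtain e c' where e: "c = e # c'" using len_c by (cases c) auto
  obtain c'' d where d: "c' = c'' @ [d]" using len_c e by (cases c' rule: rev_cases) auto
  \<comment> \<open>\<open>e\<close>, \<open>d'\<close> and \<open>d\<close> are the first, the
    second last and the last arc. With at least three arcs, \<open>e\<close> and \<open>d'\<close>
    stand at different positions, yet both turn out to have head \<open>f u\<close>.\<close>
  obtain c3 d' where d': "c'' = c3 @ [d']" using len_c e d by (cases c'' rule: rev_cases) auto
  have arcs: "e \<in> parcs T" "fst e = u" "d \<in> parcs T" "snd d = u" "snd d' = fst d"
    using c by (auto simp: e d d' tree.awalk_simps)
  have "snd e = f u"
    using arcs arc_cases[of u "snd e"] c_max(2)[of e] e by (metis Suc_n_not_le_n list.set_intros(1) prod.collapse)
  moreover have "fst d = f u"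
    using arcs arc_cases[of "fst d" u] c_max(1)[of d] e d
    by (metis Suc_n_not_le_n in_set_conv_decomp list.set_intros(2) prod.collapse)
  ultimately have "snd e = snd d'" using arcs by simp
  then show False using dist by (simp add: e d d')
qed

lemma undirected_tree_cut_graph: "undirected_tree T"
  unfolding undirected_tree_def using connected_tree no_cycle tree.pair_graph by fastforce

lemma path_to_root_cut_graph:
  assumes "u \<in> V"
  shows "path_to_root T r u = fwalk f u (depth u)"
  unfolding path_to_root_def
proof (rule the_equality)
  show "tree.apath u (fwalk f u (depth u)) r" using assms by (rule apath_fwalk)
  then show "p = fwalk f u (depth u)" if "tree.apath u p r" for p
    using tree.apath_unique that no_cycle by (metis not_le)
qed

lemma height_cut_graph: "u \<in> V \<Longrightarrow> height T r u = depth u"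
  by (simp add: height_def path_to_root_cut_graph)

lemma awalk_verts_path_to_root:
  "u \<in> V \<Longrightarrow> set (pre_digraph.awalk_verts (with_proj T) u (path_to_root T r u)) =
     (\<lambda>i. (f ^^ i) u) ` {..depth u}"
  by (auto simp: path_to_root_cut_graph pawalk_verts_fwalk simp del: upt_Suc)

lemma root_periodic: "r \<in> orbit f r"
  using root by (rule reaches_root)

text \<open>Reads \<open>f\<close> off the rooted tree away from the root, for the injectivity of
  the passage to trees.\<close>

lemma parent_eq: "u \<in> V \<Longrightarrow> u \<noteq> r \<Longrightarrow> snd (hd (path_to_root T r u)) = f u"
  by (simp add: path_to_root_cut_graph depth_step fwalk_Suc)

end

text \<open>The path from \<open>f r\<close> to \<open>r\<close> is the cycle of \<open>r\<close>
  without the arc leaving \<open>r\<close>.\<close>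

lemma (in rooted_map) height_preimage_root: "height T r (f r) = card (orbit f r) - 1"
  using card_orbit[OF root_periodic] height_cut_graph maps root by auto

lemma is_record_preimage_root:
  assumes "rooted_map V f r"
  shows "is_record (cut_graph V f r) r (f r) \<longleftrightarrow> (\<forall>x \<in> orbit f r. x \<le> f r)"
proof -
  interpret rooted_map V f r by fact
  have "f r \<in> V" using maps root by blast
  then show ?thesis
    unfolding is_record_def
    using awalk_verts_path_to_root[of "f r"] orbit_eq_image_funpow[OF root_periodic] by simp
qed

text \<open>\<open>f\<close> sends \<open>r\<close> to \<open>v\<close> and every other vertex to
  the next vertex on its path to \<open>r\<close>. As paths are unique, dropping the first arc
  leaves the path of the next vertex.\<close>

lemma rooted_tree_eq_cut_graph:
  assumes tree: "undirected_tree T" and r: "r \<in> pverts T" and v: "v \<in> pverts T"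
  obtains f where "f \<in> pverts T \<rightarrow>\<^sub>E pverts T" "f r = v" "rooted_map (pverts T) f r"
    "cut_graph (pverts T) f r = T"
proof -
  interpret pair_graph T using tree by (simp add: undirected_tree_def)
  have unique: "apath u p w \<Longrightarrow> apath u q w \<Longrightarrow> p = q" for u p q w
    using apath_unique tree by (metis undirected_tree_def)
  let ?P = "path_to_root T r"
  define f where "f = (\<lambda>u\<in>pverts T. if u = r then v else snd (hd (?P u)))"
  have P_eq: "?P u = p" if "apath u p r" for u p
    unfolding path_to_root_def using that unique by blast
  have P: "apath u (?P u) r" if "u \<in> pverts T" for u
  proof -
    have "u \<rightarrow>\<^sup>*\<^bsub>with_proj T\<^esub> r"
      using tree that r pair_sym_digraph_axioms
      by (intro connected_imp_reachable) (simp_all add: undirected_tree_def)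
    then show ?thesis using P_eq reachable_apath by metis
  qed
  have step: "?P u = (u, f u) # ?P (f u)" "(u, f u) \<in> parcs T"
    if u: "u \<in> pverts T" "u \<noteq> r" for u
  proof -
    obtain e es where e: "?P u = e # es"
      using P[OF u(1)] u(2) by (cases "?P u") (auto simp: apath_Nil_iff)
    then have "e \<in> parcs T" "fst e = u" "apath (snd e) es r"
      using P[OF u(1)] by (auto simp: apath_Cons_iff)
    moreover have "f u = snd e" using u e by (simp add: f_def)
    ultimately show "?P u = (u, f u) # ?P (f u)" "(u, f u) \<in> parcs T"
      using P_eq e by (metis prod.collapse)+
  qed
  have maps: "f u \<in> pverts T" if "u \<in> pverts T" for u
    using step(2)[OF that] v that in_arcsD2 by (cases "u = r") (auto simp: f_def)
  have reach: "r \<in> orbit f u" if "u \<in> pverts T" "u \<noteq> r" for u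
    using that
  proof (induction "length (?P u)" arbitrary: u rule: less_induct)
    case less
    show ?case
    proof (cases "f u = r")
      case True
      then show ?thesis using orbit.base[of f u] by simp
    next
      case False
      then have "r \<in> orbit f (f u)"
        using less maps step(1)[OF less.prems] by simp
      then show ?thesis by (rule orbit_subset)
    qed
  qed
  \<comment> \<open>The root goes to \<open>v\<close> and returns along the path from
    \<open>v\<close>; for \<open>v = r\<close> it is a fixed point.\<close>
  have "r \<in> orbit f r"
  proof (cases "v = r")
    case True
    then show ?thesis using orbit.base[of f r] r by (simp add: f_def)
  next
    case False
    then have "r \<in> orbit f (f r)" using reach[OF v] r by (simp add: f_def)
    then show ?thesis by (rule orbit_subset)
  qed
  then have rooted: "rooted_map (pverts T) f r"
    using pair_finite_verts maps r reach by unfold_locales blast+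
  \<comment> \<open>Putting the arc in front of the path of \<open>y\<close> gives a simple path,
    hence the path of \<open>x\<close>.\<close>
  have parent: "x \<noteq> r \<and> f x = y" if "(x, y) \<in> parcs T" "x \<notin> set (pawalk_verts y (?P y))" for x y
  proof -
    have y: "apath y (?P y) r" using that(1) P in_arcsD2 by blast
    then have "apath x ((x, y) # ?P y) r" using that by (simp add: apath_Cons_iff)
    then have "?P x = (x, y) # ?P y" "x \<noteq> r"
      using P_eq apath_nonempty_ends by blast+
    then show ?thesis using that(1) in_arcsD1 by (auto simp: f_def)
  qed
  have "y = f x \<and> x \<noteq> r \<or> x = f y \<and> y \<noteq> r" if arc: "(x, y) \<in> parcs T" for x y
  proof (cases "x \<in> set (pawalk_verts y (?P y))")
    case False
    then show ?thesis using parent[OF arc] by blast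
  next
    case True
    have y: "apath y (?P y) r" using arc P in_arcsD2 by blast
    \<comment> \<open>The part of the path of \<open>y\<close> from \<open>x\<close> on is the path
      of \<open>x\<close> and avoids \<open>y\<close>, so \<open>parent\<close> applies to the
      reversed arc.\<close>
    obtain q t where qt: "?P y = q @ t" "awalk y q x" "awalk x t r"
      using awalk_decomp[OF awalkI_apath[OF y] True] by blast
    then have "apath x t r" "set (pawalk_verts y q) \<inter> set (tl (pawalk_verts x t)) = {}"
      using y by (auto simp: apath_append_iff)
    moreover have "y \<in> set (pawalk_verts y q)" using qt(2) by (rule hd_in_awalk_verts)
    moreover have "y \<noteq> x" using arc pair_no_loops by fastforce
    moreover have "pawalk_verts x t = x # tl (pawalk_verts x t)"
      using awhd_of_awalk[OF qt(3)] awalk_verts_non_Nil[of x t] by (metis list.collapse)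
    ultimately have "y \<notin> set (pawalk_verts x (?P x))"
      using P_eq by (metis IntI empty_iff set_ConsD)
    then show ?thesis using parent arcs_symmetric[OF arc] by blast
  qed
  then have "parcs T \<subseteq> (\<lambda>u. (u, f u)) ` (pverts T - {r}) \<union> (\<lambda>u. (f u, u)) ` (pverts T - {r})"
    using in_arcsD1 in_arcsD2 by fastforce
  moreover have "(\<lambda>u. (u, f u)) ` (pverts T - {r}) \<union> (\<lambda>u. (f u, u)) ` (pverts T - {r}) \<subseteq> parcs T"
    using step(2) arcs_symmetric by auto
  ultimately have "cut_graph (pverts T) f r = T"
    unfolding cut_graph_def by (intro pair_pre_digraph.equality) auto
  moreover have "f \<in> pverts T \<rightarrow>\<^sub>E pverts T" using maps by (auto simp: f_def)
  moreover have "f r = v" using r by (simp add: f_def)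
  ultimately show ?thesis using that rooted by blast
qed

section \<open>The two bijections\<close>

definition record_maps :: "nat \<Rightarrow> nat \<Rightarrow> ((nat \<Rightarrow> nat) \<times> nat) set" where
  "record_maps n k =
     {(f, r). f \<in> {1..n} \<rightarrow>\<^sub>E {1..n} \<and> rooted_map {1..n} f r \<and>
       (\<forall>x \<in> orbit f r. x \<le> f r) \<and> card (orbit f r) = k}"

lemma connected_endofunction_rooted_map:
  assumes "rooted_map {1..n} f r"
  shows "connected_endofunction n f"
proof -
  interpret rooted_map "{1..n}" f r by fact
  interpret G: pair_fin_digraph "functional_graph n f"
    using maps by (rule pair_fin_digraph_functional_graph)
  show ?thesis
    unfolding connected_endofunction_def
  proof (rule connected_if_reachable_to)
    show "pair_wf_digraph (functional_graph n f)" ..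
    show "r \<in> pverts (functional_graph n f)" using root by simp
    fix u
    assume "u \<in> pverts (functional_graph n f)"
    then have u: "u \<in> {1..n}" by simp
    have "set (fwalk f u (depth u)) \<subseteq> (\<lambda>i. (i, f i)) ` {1..n}"
      using funpow_in_V[OF u] by (auto simp: set_fwalk)
    then have "G.awalk u (fwalk f u (depth u)) r"
      using u funpow_dist_prop[OF reaches_root[OF u]] by (simp add: G.awalk_def pcas_fwalk)
    then show "u \<rightarrow>\<^sup>*\<^bsub>with_proj (functional_graph n f)\<^esub> r" by (rule G.reachable_awalkI)
  qed
qed

text \<open>The map \<open>f\<close> determines \<open>r\<close>: it is the predecessor, on the only
  cycle, of the largest element of this cycle.\<close>

lemma bij_betw_record_maps_endofunctions:
  "bij_betw fst (record_maps n k)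
     {f \<in> {1..n} \<rightarrow>\<^sub>E {1..n}. connected_endofunction n f \<and> girth n f = k}"
  (is "bij_betw _ _ ?E")
proof (rule bij_betw_imageI)
  show "inj_on fst (record_maps n k)"
  proof (rule inj_onI, clarsimp simp: record_maps_def)
    fix f r r'
    assume "rooted_map {Suc 0..n} f r" and max: "\<forall>x\<in>orbit f r. x \<le> f r"
      and "rooted_map {Suc 0..n} f r'" and max': "\<forall>x\<in>orbit f r'. x \<le> f r'"
    then interpret a: rooted_map "{Suc 0..n}" f r + b: rooted_map "{Suc 0..n}" f r' by simp_all
    have r': "r' \<in> orbit f r" using a.root by (rule b.reaches_root)
    then have "orbit f r' = orbit f r" by (rule orbit_eq_of_periodic[OF a.root_periodic])
    then have "f r = f r'"
      using max max' orbit.base[of f r] orbit.base[of f r'] by (metis order_antisym)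
    then show "r = r'"
      using inj_on_orbit[OF a.root_periodic] a.root_periodic r' by (simp add: inj_on_def)
  qed
  show "fst ` record_maps n k = ?E"
  proof (intro equalityI subsetI)
    fix f
    assume "f \<in> fst ` record_maps n k"
    then obtain r where r: "(f, r) \<in> record_maps n k" by force
    then have con: "connected_endofunction n f"
      by (auto simp: record_maps_def intro: connected_endofunction_rooted_map)
    interpret rooted_map "{1..n}" f r using r by (simp add: record_maps_def)
    show "f \<in> ?E"
      using con r girth_eq_card_orbit[OF maps con root root_periodic] by (simp add: record_maps_def)
  next
    fix f
    assume f: "f \<in> ?E"
    then have maps: "f ` {1..n} \<subseteq> {1..n}" and con: "connected_endofunction n f" by auto
    \<comment> \<open>Connectedness includes the existence of a vertex; this excludes
      \<open>n = 0\<close>.\<close>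
    have "{1..n} \<noteq> {}"
      using con by (auto simp: connected_endofunction_def connected_def strongly_connected_def)
    then obtain a where a: "a \<in> {1..n}" "a \<in> orbit f a"
      using finite_closed_has_periodic[OF finite_atLeastAtMost _ maps] by metis
    have sub: "orbit f a \<subseteq> {1..n}" using a(1) maps by (rule orbit_subset_closed)
    have "Max (orbit f a) \<in> orbit f a" using finite_orbit[OF a(2)] a(2) by (intro Max_in) auto
    \<comment> \<open>The maximum is the image of a point of the orbit; if it is \<open>f a\<close>,
      that point is \<open>a\<close>, which lies in its own orbit by periodicity.\<close>
    then obtain r where r: "r \<in> orbit f a" "f r = Max (orbit f a)"
      using a(2) by cases auto
    have orb: "orbit f r = orbit f a" using a(2) r(1) by (rule orbit_eq_of_periodic)
    then have rr: "r \<in> {1..n}" "r \<in> orbit f r" using r(1) sub by auto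
    have "rooted_map {1..n} f r"
      using maps rr connected_endofunction_periodic_in_orbit[OF con _ rr] by unfold_locales auto
    then have "(f, r) \<in> record_maps n k"
      using f r(2) orb finite_orbit[OF a(2)] girth_eq_card_orbit[OF maps con rr]
      by (simp add: record_maps_def)
    then show "f \<in> fst ` record_maps n k" by force
  qed
qed

text \<open>The tree and its root determine \<open>f\<close> away from \<open>r\<close>, and the
  marked vertex supplies the value at \<open>r\<close>.\<close>

lemma bij_betw_record_maps_trees:
  "bij_betw (\<lambda>(f, r). ((cut_graph {1..n} f r, r), f r)) (record_maps n k)
     {((T, r), v). rooted_tree_on n T r \<and> is_record T r v \<and> int (height T r v) = int k - 1}"
  (is "bij_betw ?F _ ?R")
proof (rule bij_betw_imageI)
  show "inj_on ?F (record_maps n k)"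
  proof (rule inj_onI)
    fix x y
    assume x: "x \<in> record_maps n k" and y: "y \<in> record_maps n k" and eq: "?F x = ?F y"
    obtain f r f' r' where xy: "x = (f, r)" "y = (f', r')" by fastforce
    then have f: "(f, r) \<in> record_maps n k" and f': "(f', r') \<in> record_maps n k"
      and T: "cut_graph {1..n} f r = cut_graph {1..n} f' r'" and r: "r = r'" and v: "f r = f' r'"
      using x y eq by auto
    interpret a: rooted_map "{1..n}" f r using f by (simp add: record_maps_def)
    interpret b: rooted_map "{1..n}" f' r using f' r by (simp add: record_maps_def)
    have "f = f'"
    proof (rule PiE_ext)
      show "f \<in> {1..n} \<rightarrow>\<^sub>E {1..n}" "f' \<in> {1..n} \<rightarrow>\<^sub>E {1..n}"
        using f f' by (simp_all add: record_maps_def)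
      show "f u = f' u" if "u \<in> {1..n}" for u
        using that a.parent_eq[of u] b.parent_eq[of u] T r v by (cases "u = r") auto
    qed
    then show "x = y" using r xy by simp
  qed
  have key: "((cut_graph {1..n} f r, r), f r) \<in> ?R \<longleftrightarrow> (f, r) \<in> record_maps n k"
    if f: "f \<in> {1..n} \<rightarrow>\<^sub>E {1..n}" and rooted: "rooted_map {1..n} f r" for f r
  proof -
    interpret rooted_map "{1..n}" f r by fact
    have "rooted_tree_on n (cut_graph {1..n} f r) r"
      using undirected_tree_cut_graph root unfolding rooted_tree_on_def cut_simps by blast
    \<comment> \<open>For \<open>k = 0\<close> both sides are false: a height is never
      \<open>-1\<close>, and the orbit of \<open>r\<close> is finite and nonempty. Subtraction in
      the integers keeps this case apart from \<open>k = 1\<close>.\<close>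
    moreover have "int (height (cut_graph {1..n} f r) r (f r)) = int k - 1 \<longleftrightarrow> card (orbit f r) = k"
      using height_preimage_root card_orbit[OF root_periodic] by auto
    ultimately show ?thesis
      using is_record_preimage_root[OF rooted] f rooted by (simp add: record_maps_def)
  qed
  show "?F ` record_maps n k = ?R"
  proof (intro equalityI subsetI)
    fix x
    assume "x \<in> ?F ` record_maps n k"
    then obtain f r where x: "x = ((cut_graph {1..n} f r, r), f r)" and f: "(f, r) \<in> record_maps n k"
      by auto
    then show "x \<in> ?R" using key[of f r] by (simp add: record_maps_def)
  next
    fix x
    assume x: "x \<in> ?R"
    then obtain T r v where T: "x = ((T, r), v)" "undirected_tree T" "pverts T = {1..n}"
      "r \<in> pverts T" "v \<in> pverts T"
      by (auto simp: rooted_tree_on_def is_record_def)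
    obtain f where "f \<in> {1..n} \<rightarrow>\<^sub>E {1..n}" "f r = v" "rooted_map {1..n} f r"
      "cut_graph {1..n} f r = T"
      using rooted_tree_eq_cut_graph[OF T(2,4,5)] T(3) by metis
    then show "x \<in> ?F ` record_maps n k"
      using key[of f r] x T(1) by (intro image_eqI[of _ _ "(f, r)"]) simp_all
  qed
qed

theorem theorem1p1:
  fixes k n :: nat
  assumes "k \<le> n"
  shows "card {((T, r), v). rooted_tree_on n T r \<and> is_record T r v \<and> int (height T r v) = int k - 1}
       = card {f \<in> {1..n} \<rightarrow>\<^sub>E {1..n}. connected_endofunction n f \<and> girth n f = k}"
  using bij_betw_same_card[OF bij_betw_record_maps_trees]
    bij_betw_same_card[OF bij_betw_record_maps_endofunctions] by metis

end
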